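(* The following two statements are equivalent. (a) Every finite bridgeless cubic graph $G$ has six (not necessarily distinct) perfect matchings $M_1,\dots,M_6$ such that each edge of $G$ belongs to exactly two of them (i.e. $|\{j : e\in M_j\}|=2$ for every $e\in E(G)$). (b) Every infinite bridgeless cubic graph $G$ has six (not necessarily distinct) perfect matchings $M_1,\dots,M_6$ such that each edge of $G$ belongs to exactly two of them.
   Context: Graphs are simple (no loops, no parallel edges), not necessarily connected, and may be infinite. A graph is cubic if every vertex has degree exactly 3, and bridgeless if it has no edge whose deletion increases the number of connected components. A perfect matching of $G$ is a set $M\subseteq E(G)$ such that every vertex of $G$ is incident with exactly one edge of $M$. *)

theory Defs
  imports Main
begin

text \<open>
  A graph is a pair of a vertex set \<open>V\<close> and an edge set \<open>E\<close>, edges being two-element subsets of \<open>V\<close>;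
  so loops and parallel edges are excluded, and both sets may be infinite.
\<close>

definition simple_graph :: "'a set \<Rightarrow> 'a set set \<Rightarrow> bool" where
  "simple_graph V E \<longleftrightarrow> (\<forall>e\<in>E. \<exists>u\<in>V. \<exists>v\<in>V. u \<noteq> v \<and> e = {u, v})"

definition cubic :: "'a set \<Rightarrow> 'a set set \<Rightarrow> bool" where
  "cubic V E \<longleftrightarrow> (\<forall>v\<in>V. card {e\<in>E. v \<in> e} = 3)"

definition connected_rel :: "'a set \<Rightarrow> 'a set set \<Rightarrow> ('a \<times> 'a) set" where
  "connected_rel V E = {(u, v). u \<in> V \<and> v \<in> V \<and> (u, v) \<in> {(x, y). {x, y} \<in> E}\<^sup>*}"

definition components :: "'a set \<Rightarrow> 'a set set \<Rightarrow> 'a set set" where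
  "components V E = V // connected_rel V E"

text \<open>
  Deleting a bridge increases the number of components. In a graph with infinitely many components
  a comparison of cardinalities would never detect this, so the components are
  counted inside the component \<open>C\<close> containing the edge: deletion turns this one component into several.
  Lemma \<open>bridge_iff_card_components\<close> below shows that this is the comparison of the
  total numbers of components whenever there are only finitely many.
\<close>

definition bridge :: "'a set \<Rightarrow> 'a set set \<Rightarrow> 'a set \<Rightarrow> bool" where
  "bridge V E e \<longleftrightarrow> e \<in> E \<and>
     (\<exists>C\<in>components V E. e \<subseteq> C \<and> card {D \<in> components V (E - {e}). D \<subseteq> C} > 1)"

definition bridgeless :: "'a set \<Rightarrow> 'a set set \<Rightarrow> bool" where
  "bridgeless V E \<longleftrightarrow> (\<forall>e\<in>E. \<not> bridge V E e)"

definition perfect_matching :: "'a set \<Rightarrow> 'a set set \<Rightarrow> 'a set set \<Rightarrow> bool" where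
  "perfect_matching V E M \<longleftrightarrow> M \<subseteq> E \<and> (\<forall>v\<in>V. \<exists>!e. e \<in> M \<and> v \<in> e)"

definition six_matchings_double_cover :: "'a set \<Rightarrow> 'a set set \<Rightarrow> bool" where
  "six_matchings_double_cover V E \<longleftrightarrow>
     (\<exists>M :: nat \<Rightarrow> 'a set set. (\<forall>j\<in>{1..6}. perfect_matching V E (M j)) \<and>
        (\<forall>e\<in>E. card {j\<in>{1..6}. e \<in> M j} = 2))"

lemma simple_graph_edge:
  assumes "simple_graph V E" and "{u, v} \<in> E"
  shows "u \<in> V" "v \<in> V"
proof -
  obtain a b where "a \<in> V" "b \<in> V" "{u, v} = {a, b}"
    using assms unfolding simple_graph_def by metis
  then show "u \<in> V" "v \<in> V" by (auto simp: doubleton_eq_iff)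
qed

lemma equiv_connected_rel: "equiv V (connected_rel V E)"
proof (rule equivI)
  let ?A = "{(x, y). {x, y} \<in> E}"
  have "sym ?A" by (auto simp: sym_def insert_commute)
  then have "sym (?A\<^sup>*)" by (rule sym_rtrancl)
  then show "sym (connected_rel V E)"
    by (auto simp: connected_rel_def sym_def)
  show "trans (connected_rel V E)"
    by (auto simp: connected_rel_def trans_def intro: rtrancl_trans)
qed (auto simp: connected_rel_def refl_on_def)

lemma components_delete_edge:
  fixes V E u v
  defines "R \<equiv> connected_rel V E"
  defines "R' \<equiv> connected_rel V (E - {{u, v}})"
  assumes G: "simple_graph V E" and e: "{u, v} \<in> E"
  shows "components V (E - {{u, v}}) = (components V E - {R `` {u}}) \<union> {R' `` {u}, R' `` {v}}"
    and "{D \<in> components V (E - {{u, v}}). D \<subseteq> R `` {u}} = {R' `` {u}, R' `` {v}}"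
    and "R' `` {u} \<notin> components V E - {R `` {u}}"
    and "R' `` {v} \<notin> components V E - {R `` {u}}"
    and "R `` {u} \<in> components V E"
    and "{u, v} \<subseteq> R `` {u}"
proof -
  let ?A = "{(x, y). {x, y} \<in> E}"
  let ?A' = "{(x, y). {x, y} \<in> E - {{u, v}}}"
  have eqR: "equiv V R" and eqR': "equiv V R'"
    unfolding R_def R'_def by (rule equiv_connected_rel)+
  have uv: "u \<in> V" "v \<in> V" by (rule simple_graph_edge[OF G e])+
  have "?A'\<^sup>* \<subseteq> ?A\<^sup>*" by (rule rtrancl_mono) auto
  then have sub: "R' \<subseteq> R" unfolding R_def R'_def connected_rel_def by auto
  have reflR: "(x, x) \<in> R" "(x, x) \<in> R'" if "x \<in> V" for x
    using that by (auto simp: R_def R'_def connected_rel_def)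
  have uvR: "(u, v) \<in> R" unfolding R_def connected_rel_def using uv e by auto
  have uu: "(u, u) \<in> R'" "(v, v) \<in> R'" "(u, u) \<in> R"
    by (intro reflR uv)+
  have symR: "sym R" and symR': "sym R'" and trR: "trans R" and trR': "trans R'"
    using eqR eqR' by (auto elim: equivE)
  have key: "(x, y) \<in> R' \<or> (((x, u) \<in> R' \<or> (x, v) \<in> R') \<and> ((y, u) \<in> R' \<or> (y, v) \<in> R'))"
    if "(x, y) \<in> R" for x y
  proof -
    have xV: "x \<in> V" and "(x, y) \<in> ?A\<^sup>*" using that by (auto simp: R_def connected_rel_def)
    from this(2) show ?thesis
    proof (induction rule: rtrancl_induct)
      case base
      show ?case using reflR(2)[OF xV] by blast
    next
      case (step y z)
      have yz: "y \<in> V" "z \<in> V" using simple_graph_edge[OF G] step.hyps(2) by auto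
      show ?case
      proof (cases "{y, z} = {u, v}")
        case True
        then have "(y = u \<and> z = v) \<or> (y = v \<and> z = u)" by (auto simp: doubleton_eq_iff)
        then show ?thesis using step.IH uu by blast
      next
        case False
        then have "(y, z) \<in> R'" using step yz unfolding R'_def connected_rel_def by auto
        then show ?thesis using step.IH symR' trR' by (meson symD transD)
      qed
    qed
  qed
  have split: "(x, u) \<in> R' \<or> (x, v) \<in> R'" if "(u, x) \<in> R" for x
    using key[OF that] symR' by (meson symD)
  have same: "R `` {x} = R' `` {x}" if "(u, x) \<notin> R" for x
  proof -
    have "(x, u) \<notin> R" "(x, v) \<notin> R" using that uvR symR trR by (meson symD transD)+
    then show ?thesis using key sub by blast
  qed
  have cls': "R' `` {x} = R' `` {u} \<or> R' `` {x} = R' `` {v}" if "(u, x) \<in> R" for x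
    using split[OF that] equiv_class_eq[OF eqR'] by blast
  have inC: "R' `` {u} \<subseteq> R `` {u}" "R' `` {v} \<subseteq> R `` {u}"
    using sub uvR trR by (auto dest: transD)
  have comp: "components V E = (\<lambda>x. R `` {x}) ` V"
    "components V (E - {{u, v}}) = (\<lambda>x. R' `` {x}) ` V"
    by (auto simp: components_def quotient_def R_def R'_def)
  have neq: "R `` {x} \<noteq> R `` {u} \<longleftrightarrow> (u, x) \<notin> R" if "x \<in> V" for x
    using eq_equiv_class_iff[OF eqR that uv(1)] symR by (meson symD)
  show "R `` {u} \<in> components V E" using uv comp by auto
  show "{u, v} \<subseteq> R `` {u}" using uu uvR by auto
  show 1: "components V (E - {{u, v}}) = (components V E - {R `` {u}}) \<union> {R' `` {u}, R' `` {v}}"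
  proof (intro equalityI subsetI)
    fix D assume "D \<in> components V (E - {{u, v}})"
    then obtain x where x: "x \<in> V" "D = R' `` {x}" using comp by auto
    show "D \<in> (components V E - {R `` {u}}) \<union> {R' `` {u}, R' `` {v}}"
    proof (cases "(u, x) \<in> R")
      case True
      then show ?thesis using cls' x by blast
    next
      case False
      then have "D = R `` {x}" "R `` {x} \<noteq> R `` {u}" using same[OF False] neq[OF x(1)] x(2) False by simp_all
      then show ?thesis using x comp by auto
    qed
  next
    fix D assume "D \<in> (components V E - {R `` {u}}) \<union> {R' `` {u}, R' `` {v}}"
    then consider "D \<in> components V E" "D \<noteq> R `` {u}" | "D = R' `` {u}" | "D = R' `` {v}" by blast
    then show "D \<in> components V (E - {{u, v}})"
    proof cases
      case 1
      then obtain x where x: "x \<in> V" "D = R `` {x}" using comp by auto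
      then have "D = R' `` {x}" using 1 neq same by metis
      then show ?thesis using x comp by auto
    qed (use uv comp in auto)
  qed
  have disj: "D = R `` {u}" if D: "D \<in> components V E" "x \<in> D" "(u, x) \<in> R" for D x
  proof -
    obtain y where y: "y \<in> V" "D = R `` {y}" using D(1) unfolding comp(1) by blast
    have "(x, y) \<in> R" using D(2) y(2) symR by (auto dest: symD)
    then have "(u, y) \<in> R" using D(3) trR by (blast dest: transD)
    then show ?thesis using neq[OF y(1)] y(2) by simp
  qed
  show "R' `` {u} \<notin> components V E - {R `` {u}}"
    using disj[of "R' `` {u}" u] uu by auto
  show "R' `` {v} \<notin> components V E - {R `` {u}}"
    using disj[of "R' `` {v}" v] uu uvR by auto
  have "\<not> D \<subseteq> R `` {u}" if D: "D \<in> components V E - {R `` {u}}" for D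
  proof -
    obtain y where y: "y \<in> V" "D = R `` {y}" using D unfolding comp(1) by blast
    then have "y \<in> D" using reflR(1) by simp
    then show ?thesis using disj[of D y] D by blast
  qed
  then show "{D \<in> components V (E - {{u, v}}). D \<subseteq> R `` {u}} = {R' `` {u}, R' `` {v}}"
    unfolding 1 using inC by blast
qed

lemma bridge_iff_not_connected:
  assumes G: "simple_graph V E" and e: "{u, v} \<in> E"
  shows "bridge V E {u, v} \<longleftrightarrow> (u, v) \<notin> connected_rel V (E - {{u, v}})"
proof -
  let ?R = "connected_rel V E" and ?R' = "connected_rel V (E - {{u, v}})"
  note c = components_delete_edge[OF G e]
  have uv: "u \<in> V" "v \<in> V" by (rule simple_graph_edge[OF G e])+
  have uniq: "C = ?R `` {u}" if C: "C \<in> components V E" "{u, v} \<subseteq> C" for C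
  proof -
    obtain y where y: "y \<in> V" "C = ?R `` {y}" using C(1) by (auto simp: components_def quotient_def)
    then have "(y, u) \<in> ?R" using C(2) by simp
    then show ?thesis using y(2) equiv_class_eq[OF equiv_connected_rel] by metis
  qed
  have "bridge V E {u, v} \<longleftrightarrow>
      card {D \<in> components V (E - {{u, v}}). D \<subseteq> ?R `` {u}} > 1"
  proof
    assume "bridge V E {u, v}"
    then obtain C where "C \<in> components V E" "{u, v} \<subseteq> C"
      and *: "card {D \<in> components V (E - {{u, v}}). D \<subseteq> C} > 1"
      unfolding bridge_def by blast
    from this(1,2) have "C = ?R `` {u}" by (rule uniq)
    with * show "card {D \<in> components V (E - {{u, v}}). D \<subseteq> ?R `` {u}} > 1" by (simp only:)
  next
    assume "card {D \<in> components V (E - {{u, v}}). D \<subseteq> ?R `` {u}} > 1"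
    then show "bridge V E {u, v}"
      unfolding bridge_def by (intro conjI e bexI[OF _ c(5)] c(6))
  qed
  also have "\<dots> \<longleftrightarrow> card {?R' `` {u}, ?R' `` {v}} > 1" unfolding c(2) ..
  also have "\<dots> \<longleftrightarrow> ?R' `` {u} \<noteq> ?R' `` {v}" by (cases "?R' `` {u} = ?R' `` {v}") auto
  also have "\<dots> \<longleftrightarrow> (u, v) \<notin> ?R'" using eq_equiv_class_iff[OF equiv_connected_rel uv] by metis
  finally show ?thesis .
qed

lemma bridge_iff_card_components:
  assumes G: "simple_graph V E" and fin: "finite (components V E)"
  shows "bridge V E e \<longleftrightarrow> e \<in> E \<and> card (components V (E - {e})) > card (components V E)"
proof (cases "e \<in> E")
  case True
  then obtain u v where e: "e = {u, v}" "u \<in> V" "v \<in> V" using G unfolding simple_graph_def by blast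
  have e': "{u, v} \<in> E" using True e by simp
  let ?R = "connected_rel V E" and ?R' = "connected_rel V (E - {{u, v}})"
  note c = components_delete_edge[OF G e']
  have "card (components V (E - {{u, v}})) =
      card (components V E - {?R `` {u}}) + card {?R' `` {u}, ?R' `` {v}}"
    unfolding c(1) by (rule card_Un_disjoint) (use fin c(3,4) in auto)
  moreover have "card (components V E) = Suc (card (components V E - {?R `` {u}}))"
    using fin c(5) by (rule card.remove)
  moreover have "(u, v) \<notin> ?R' \<longleftrightarrow> ?R' `` {u} \<noteq> ?R' `` {v}"
    using eq_equiv_class_iff[OF equiv_connected_rel e(2,3)] by metis
  ultimately show ?thesis
    unfolding e(1) bridge_iff_not_connected[OF G e'] using e'
    by (cases "?R' `` {u} = ?R' `` {v}") auto
qed (simp add: bridge_def)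

end

theory Submission
  imports Defs "HOL-Analysis.Function_Topology"
begin

text \<open>
  Six perfect matchings covering every edge twice are the same as an assignment of two-element
  subsets of \<open>{1..6}\<close> to the edges such that edges sharing a vertex receive disjoint sets: three
  disjoint pairs exhaust \<open>{1..6}\<close>. This is a constraint on pairs of edges with finitely many values,
  so by Tychonoff's theorem it suffices to solve it on every finite set of edges of the
  infinite graph. A finite set of edges lies in a finite union \<open>F\<close> of cycles, whose vertices have degree
  2 or 3. Joining the corresponding vertices of degree 2 in two copies of \<open>F\<close> yields a finite cubic
  graph. It is bridgeless: if \<open>v\<close> were the only vertex of degree 2 in its component of \<open>F\<close>,
  then the third edge at \<open>v\<close> would be a bridge of the infinite graph. Conversely, a finite graph is
  coloured by colouring the disjoint union of infinitely many copies of it.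
\<close>

section \<open>Edges and connectivity\<close>

lemma simple_graph_edgeE:
  assumes "simple_graph V E" and "e \<in> E"
  obtains u v where "u \<in> V" "v \<in> V" "u \<noteq> v" "e = {u, v}"
  using assms unfolding simple_graph_def by meson

lemma simple_graph_edge_at:
  assumes "simple_graph V E" and "e \<in> E" and "v \<in> e"
  shows "\<exists>u. u \<noteq> v \<and> e = {v, u}"
proof -
  obtain a b where "a \<noteq> b" "e = {a, b}" using assms by (elim simple_graph_edgeE)
  then show ?thesis using assms(3) by (cases "v = a") auto
qed

text \<open>Reachability along \<open>adj E\<close> depends on the edge set alone, unlike
  \<open>connected_rel\<close>. Edge sets can thus be shrunk, united and mapped without carrying
  vertex sets along.\<close>

definition adj :: "'a set set \<Rightarrow> ('a \<times> 'a) set" where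
  "adj E = {(x, y). {x, y} \<in> E}"

lemma adj_iff [simp]: "(x, y) \<in> adj E \<longleftrightarrow> {x, y} \<in> E"
  by (simp add: adj_def)

lemma rtrancl_adj_sym: "(x, y) \<in> (adj E)\<^sup>* \<Longrightarrow> (y, x) \<in> (adj E)\<^sup>*"
proof -
  have "sym (adj E)" by (auto simp: sym_def insert_commute)
  then show "(x, y) \<in> (adj E)\<^sup>* \<Longrightarrow> (y, x) \<in> (adj E)\<^sup>*"
    by (metis sym_rtrancl symD)
qed

lemma rtrancl_adj_mono: "(x, y) \<in> (adj E)\<^sup>* \<Longrightarrow> E \<subseteq> F \<Longrightarrow> (x, y) \<in> (adj F)\<^sup>*"
  by (rule subsetD[OF rtrancl_mono]) auto

lemma rtrancl_adj_image:
  assumes "(x, y) \<in> (adj E)\<^sup>*"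
  shows "(h x, h y) \<in> (adj ((`) h ` E))\<^sup>*"
  using assms
proof (induction rule: rtrancl_induct)
  case (step y z)
  then have "h ` {y, z} \<in> (`) h ` E" by (intro imageI) simp
  then have "(h y, h z) \<in> adj ((`) h ` E)" by simp
  with step.IH show ?case by (rule rtrancl_into_rtrancl)
qed simp

text \<open>Cut a walk at its first and its last use of the new edge. If both cross it in the same
  direction, one of the last two alternatives results; otherwise the two outer pieces already join
  \<open>u\<close> to \<open>v\<close> in \<open>P\<close>. The induction keeps track of this step
  by step.\<close>

lemma rtrancl_adj_insert:
  assumes "(u, v) \<in> (adj (insert {x, y} P))\<^sup>*"
  shows "(u, v) \<in> (adj P)\<^sup>* \<or> (u, x) \<in> (adj P)\<^sup>* \<and> (y, v) \<in> (adj P)\<^sup>*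
       \<or> (u, y) \<in> (adj P)\<^sup>* \<and> (x, v) \<in> (adj P)\<^sup>*"
  using assms
proof (induction rule: rtrancl_induct)
  case (step a b)
  show ?case
  proof (cases "{a, b} \<in> P")
    case True
    then have "(a, b) \<in> adj P" by simp
    with step.IH show ?thesis by (meson rtrancl_into_rtrancl)
  next
    case False
    then have "a = x \<and> b = y \<or> a = y \<and> b = x"
      using step.hyps(2) by (auto simp: doubleton_eq_iff)
    with step.IH show ?thesis by blast
  qed
qed simp

lemma rtrancl_adj_finite:
  assumes "(u, v) \<in> (adj E)\<^sup>*"
  shows "\<exists>P. finite P \<and> P \<subseteq> E \<and> (u, v) \<in> (adj P)\<^sup>*"
  using assms
proof (induction rule: rtrancl_induct)
  case base
  show ?case by (rule exI[of _ "{}"]) simp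
next
  case (step y z)
  then obtain P where P: "finite P" "P \<subseteq> E" "(u, y) \<in> (adj P)\<^sup>*" by blast
  have "(u, y) \<in> (adj (insert {y, z} P))\<^sup>*" using P(3) by (rule rtrancl_adj_mono) auto
  moreover have "(y, z) \<in> adj (insert {y, z} P)" by simp
  ultimately have "(u, z) \<in> (adj (insert {y, z} P))\<^sup>*" by (rule rtrancl_into_rtrancl)
  moreover have "finite (insert {y, z} P)" "insert {y, z} P \<subseteq> E" using P step.hyps by auto
  ultimately show ?case by blast
qed

text \<open>Absence of bridges by detours instead of a count of components. A detour survives when
  edges are added, which makes the notion easy to verify in unions.\<close>

definition bridge_free :: "'a set set \<Rightarrow> bool" where
  "bridge_free E \<longleftrightarrow> (\<forall>x y. {x, y} \<in> E \<longrightarrow> (x, y) \<in> (adj (E - {{x, y}}))\<^sup>*)"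

lemma bridgeless_iff_bridge_free:
  assumes G: "simple_graph V E"
  shows "bridgeless V E \<longleftrightarrow> bridge_free E"
proof -
  have conn: "(u, v) \<in> connected_rel V (E - {{u, v}}) \<longleftrightarrow> (u, v) \<in> (adj (E - {{u, v}}))\<^sup>*"
    if "{u, v} \<in> E" for u v
    using simple_graph_edge[OF G that] by (simp add: connected_rel_def adj_def)
  have "bridgeless V E \<longleftrightarrow> (\<forall>u v. {u, v} \<in> E \<longrightarrow> \<not> bridge V E {u, v})"
    using G unfolding bridgeless_def simple_graph_def by metis
  then show ?thesis
    unfolding bridge_free_def using bridge_iff_not_connected[OF G] conn by metis
qed

lemma bridge_free_Union:
  assumes "\<And>C. C \<in> \<C> \<Longrightarrow> bridge_free C"
  shows "bridge_free (\<Union>\<C>)"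
  unfolding bridge_free_def
proof (intro allI impI)
  fix x y assume "{x, y} \<in> \<Union>\<C>"
  then obtain C where C: "C \<in> \<C>" "{x, y} \<in> C" by blast
  then have "(x, y) \<in> (adj (C - {{x, y}}))\<^sup>*" using assms unfolding bridge_free_def by blast
  then show "(x, y) \<in> (adj (\<Union>\<C> - {{x, y}}))\<^sup>*"
    by (rule rtrancl_adj_mono) (use C in blast)
qed

lemma bridge_free_image:
  assumes "bridge_free E" and inj: "inj_on h (\<Union>E)"
  shows "bridge_free ((`) h ` E)"
  unfolding bridge_free_def
proof (intro allI impI)
  fix x y assume "{x, y} \<in> (`) h ` E"
  then obtain e where e: "e \<in> E" "h ` e = {x, y}" by auto
  obtain u where u: "u \<in> e" "h u = x" using e(2) by (metis image_iff insertI1)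
  obtain v where v: "v \<in> e" "h v = y" using e(2) by (metis image_iff insertI1 insert_commute)
  have inje: "inj_on h e" using inj e(1) by (meson Union_upper inj_on_subset)
  have "e = {u, v}"
  proof
    show "e \<subseteq> {u, v}"
    proof
      fix w assume "w \<in> e"
      then have "h w \<in> {h u, h v}" using e(2) u(2) v(2) by blast
      then show "w \<in> {u, v}" using inje \<open>w \<in> e\<close> u(1) v(1) by (auto dest: inj_onD)
    qed
  qed (use u v in auto)
  then have "(u, v) \<in> (adj (E - {e}))\<^sup>*" using assms(1) e(1) unfolding bridge_free_def by blast
  then have "(x, y) \<in> (adj ((`) h ` (E - {e})))\<^sup>*" using rtrancl_adj_image u(2) v(2) by metis
  moreover have "(`) h ` (E - {e}) \<subseteq> (`) h ` E - {{x, y}}"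
  proof -
    have "h ` f \<noteq> h ` e" if "f \<in> E" "f \<noteq> e" for f
      using inj_on_image_eq_iff[OF inj, of f e] that e(1) by blast
    then show ?thesis using e(2) by auto
  qed
  ultimately show "(x, y) \<in> (adj ((`) h ` E - {{x, y}}))\<^sup>*" by (rule rtrancl_adj_mono)
qed

text \<open>The set \<open>C\<close> is a cycle through the edge, obtained as the edge plus a detour
  \<open>P\<close> with the fewest edges. That it is a cycle need not be proved: by minimality every
  edge of \<open>P\<close> separates \<open>u\<close> from \<open>v\<close> within \<open>P\<close>,
  and this alone provides the detours.\<close>

lemma bridge_free_finite_superset_edge:
  assumes bf: "bridge_free E" and e: "{u, v} \<in> E"
  shows "\<exists>C. finite C \<and> C \<subseteq> E \<and> {u, v} \<in> C \<and> bridge_free C"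
proof -
  let ?Q = "\<lambda>P. finite P \<and> P \<subseteq> E - {{u, v}} \<and> (u, v) \<in> (adj P)\<^sup>*"
  have "(u, v) \<in> (adj (E - {{u, v}}))\<^sup>*" using bf e unfolding bridge_free_def by blast
  then obtain P\<^sub>0 where "?Q P\<^sub>0" using rtrancl_adj_finite by metis
  from ex_has_least_nat[of ?Q, OF this, of card] obtain P
    where P: "?Q P" and min: "\<And>P'. ?Q P' \<Longrightarrow> card P \<le> card P'"
    by (elim exE conjE) simp
  let ?C = "insert {u, v} P"
  have "bridge_free ?C"
    unfolding bridge_free_def
  proof (intro allI impI)
    fix x y assume xy: "{x, y} \<in> ?C"
    show "(x, y) \<in> (adj (?C - {{x, y}}))\<^sup>*"
    proof (cases "{x, y} = {u, v}")
      case True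
      then have "?C - {{x, y}} = P" using P by auto
      moreover have "x = u \<and> y = v \<or> x = v \<and> y = u" using True by (auto simp: doubleton_eq_iff)
      ultimately show ?thesis using P rtrancl_adj_sym by metis
    next
      case False
      let ?P' = "P - {{x, y}}"
      have g: "{x, y} \<in> P" using xy False by auto
      then have "card ?P' < card P" using P by (meson card_Diff1_less)
      then have not: "(u, v) \<notin> (adj ?P')\<^sup>*" using min[of ?P'] P by auto
      have "(u, v) \<in> (adj (insert {x, y} ?P'))\<^sup>*" using P g by (simp add: insert_absorb)
      then have alt: "(u, x) \<in> (adj ?P')\<^sup>* \<and> (y, v) \<in> (adj ?P')\<^sup>* \<or>
          (u, y) \<in> (adj ?P')\<^sup>* \<and> (x, v) \<in> (adj ?P')\<^sup>*"
        using rtrancl_adj_insert[of u v x y ?P'] not by simp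
      have mono: "(a, b) \<in> (adj ?P')\<^sup>* \<Longrightarrow> (a, b) \<in> (adj (?C - {{x, y}}))\<^sup>*" for a b
        by (erule rtrancl_adj_mono) blast
      have "(u, v) \<in> adj (?C - {{x, y}})" using False by simp
      then have uv: "(u, v) \<in> (adj (?C - {{x, y}}))\<^sup>*" by (rule r_into_rtrancl)
      \<comment> \<open>One end of \<open>{x, y}\<close> is still joined to \<open>u\<close> and the
        other one to \<open>v\<close>, so the detour runs through the edge
        \<open>{u, v}\<close>.\<close>
      from alt show ?thesis
      proof (elim disjE conjE)
        assume a: "(u, x) \<in> (adj ?P')\<^sup>*" and b: "(y, v) \<in> (adj ?P')\<^sup>*"
        show ?thesis
          using rtrancl_trans[OF mono[OF rtrancl_adj_sym[OF a]]
            rtrancl_trans[OF uv mono[OF rtrancl_adj_sym[OF b]]]] .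
      next
        assume a: "(u, y) \<in> (adj ?P')\<^sup>*" and b: "(x, v) \<in> (adj ?P')\<^sup>*"
        show ?thesis
          using rtrancl_trans[OF mono[OF b] rtrancl_trans[OF rtrancl_adj_sym[OF uv] mono[OF a]]] .
      qed
    qed
  qed
  moreover have "finite ?C" "?C \<subseteq> E" using P e by blast+
  ultimately show ?thesis by blast
qed

lemma bridge_free_finite_superset:
  assumes G: "simple_graph V E" and bf: "bridge_free E" and T: "finite T" "T \<subseteq> E"
  shows "\<exists>F. finite F \<and> T \<subseteq> F \<and> F \<subseteq> E \<and> bridge_free F"
proof -
  have "\<forall>e\<in>T. \<exists>C. finite C \<and> C \<subseteq> E \<and> e \<in> C \<and> bridge_free C"
  proof
    fix e assume "e \<in> T"
    then have "e \<in> E" using T(2) by blast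
    then obtain u v where "e = {u, v}" "{u, v} \<in> E" using simple_graph_edgeE[OF G] by metis
    then show "\<exists>C. finite C \<and> C \<subseteq> E \<and> e \<in> C \<and> bridge_free C"
      using bridge_free_finite_superset_edge[OF bf] by simp
  qed
  from bchoice[OF this] obtain C
    where C: "\<And>e. e \<in> T \<Longrightarrow> finite (C e) \<and> C e \<subseteq> E \<and> e \<in> C e \<and> bridge_free (C e)"
    by blast
  have "bridge_free (\<Union>(C ` T))" by (rule bridge_free_Union) (use C in blast)
  moreover have "finite (\<Union>(C ` T))" using T(1) C by (intro finite_UN_I) simp_all
  moreover have "T \<subseteq> \<Union>(C ` T)" "\<Union>(C ` T) \<subseteq> E" using C by blast+
  ultimately show ?thesis by blast
qed

section \<open>Colourings by pairs\<close>

text \<open>Here \<open>\<phi> e\<close> plays the role of the set of all \<open>j\<close> with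
  \<open>e \<in> M j\<close>. Vertex degrees do not occur, so the notion makes sense for arbitrary
  subsets of the edges, as compactness requires.\<close>

definition pair_coloring :: "'a set set \<Rightarrow> ('a set \<Rightarrow> nat set) \<Rightarrow> bool" where
  "pair_coloring E \<phi> \<longleftrightarrow> (\<forall>e\<in>E. \<phi> e \<subseteq> {1..6} \<and> card (\<phi> e) = 2) \<and>
     (\<forall>e\<in>E. \<forall>f\<in>E. e \<noteq> f \<and> e \<inter> f \<noteq> {} \<longrightarrow> \<phi> e \<inter> \<phi> f = {})"

lemma six_matchings_iff_pair_coloring:
  assumes G: "simple_graph V E" and cub: "cubic V E"
  shows "six_matchings_double_cover V E \<longleftrightarrow> (\<exists>\<phi>. pair_coloring E \<phi>)"
proof
  assume "six_matchings_double_cover V E"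
  then obtain M where pm: "\<And>j. j \<in> {1..6} \<Longrightarrow> perfect_matching V E (M j)"
    and two: "\<And>e. e \<in> E \<Longrightarrow> card {j\<in>{1..6::nat}. e \<in> M j} = 2"
    unfolding six_matchings_double_cover_def by blast
  have disj: "{j\<in>{1..6}. e \<in> M j} \<inter> {j\<in>{1..6}. f \<in> M j} = {}"
    if ef: "e \<in> E" "f \<in> E" "e \<noteq> f" "e \<inter> f \<noteq> {}" for e f
  proof -
    obtain v where v: "v \<in> e" "v \<in> f" using ef by blast
    have "v \<in> V" using simple_graph_edgeE[OF G ef(1)] v(1) by blast
    then have "e = f" if "j \<in> {1..6}" "e \<in> M j" "f \<in> M j" for j
      using pm[OF that(1)] that(2,3) v unfolding perfect_matching_def by metis
    then show ?thesis using ef(3) by blast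
  qed
  have "pair_coloring E (\<lambda>e. {j\<in>{1..6}. e \<in> M j})"
    unfolding pair_coloring_def by (intro conjI ballI impI two disj) auto
  then show "\<exists>\<phi>. pair_coloring E \<phi>" by blast
next
  assume "\<exists>\<phi>. pair_coloring E \<phi>"
  then obtain \<phi> where \<phi>: "pair_coloring E \<phi>" by blast
  have range: "\<phi> e \<subseteq> {1..6}" and two: "card (\<phi> e) = 2" if "e \<in> E" for e
    using \<phi> that unfolding pair_coloring_def by simp_all
  have disj: "\<phi> e \<inter> \<phi> f = {}" if "e \<in> E" "f \<in> E" "e \<noteq> f" "e \<inter> f \<noteq> {}" for e f
    using \<phi> that unfolding pair_coloring_def by simp
  have "perfect_matching V E {e\<in>E. j \<in> \<phi> e}" if j: "j \<in> {1..6}" for j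
    unfolding perfect_matching_def
  proof (intro conjI ballI)
    fix v assume "v \<in> V"
    let ?S = "{e\<in>E. v \<in> e}"
    have three: "card ?S = 3" using cub \<open>v \<in> V\<close> by (simp add: cubic_def)
    then have "finite ?S" by (simp add: card_ge_0_finite)
    moreover have "\<forall>e\<in>?S. finite (\<phi> e)" using two by (simp add: card_ge_0_finite)
    moreover have dj: "\<phi> e \<inter> \<phi> f = {}" if "e \<in> ?S" "f \<in> ?S" "e \<noteq> f" for e f
      by (rule disj) (use that in blast)+
    then have "\<forall>e\<in>?S. \<forall>f\<in>?S. e \<noteq> f \<longrightarrow> \<phi> e \<inter> \<phi> f = {}" by (intro ballI impI)
    ultimately have "card (\<Union>(\<phi> ` ?S)) = (\<Sum>e\<in>?S. card (\<phi> e))"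
      by (rule card_UN_disjoint)
    also have "\<dots> = (\<Sum>e\<in>?S. 2)" by (rule sum.cong) (simp_all add: two)
    also have "\<dots> = card {1..6::nat}" using three by simp
    finally have "card (\<Union>(\<phi> ` ?S)) = card {1..6::nat}" .
    moreover have "\<Union>(\<phi> ` ?S) \<subseteq> {1..6}" using range by blast
    ultimately have "\<Union>(\<phi> ` ?S) = {1..6}" by (intro card_subset_eq) simp_all
    \<comment> \<open>Since all six indices occur at \<open>v\<close>, some edge at \<open>v\<close>
      carries \<open>j\<close>; disjointness of the pairs at \<open>v\<close> makes it the only
      one.\<close>
    then obtain e where e: "e \<in> ?S" "j \<in> \<phi> e" using j by blast
    show "\<exists>!e. e \<in> {e\<in>E. j \<in> \<phi> e} \<and> v \<in> e"
    proof (rule ex1I)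
      show "e \<in> {e\<in>E. j \<in> \<phi> e} \<and> v \<in> e" using e by simp
      show "f = e" if "f \<in> {e\<in>E. j \<in> \<phi> e} \<and> v \<in> f" for f
        using dj[of f e] e that by blast
    qed
  qed simp
  moreover have "card {j\<in>{1..6}. e \<in> {e\<in>E. j \<in> \<phi> e}} = 2" if "e \<in> E" for e
  proof -
    have "{j\<in>{1..6}. e \<in> {e\<in>E. j \<in> \<phi> e}} = \<phi> e" using range[OF that] that by blast
    then show ?thesis using two[OF that] by (simp only:)
  qed
  ultimately show "six_matchings_double_cover V E"
    unfolding six_matchings_double_cover_def
    by (intro exI[of _ "\<lambda>j. {e\<in>E. j \<in> \<phi> e}"] conjI ballI)
qed

text \<open>The colouring is pulled back along \<open>h\<close>. As the image of \<open>E\<close>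
  only has to lie inside \<open>E'\<close>, this covers both transport to an isomorphic graph and
  restriction to one copy inside a larger graph.\<close>

lemma pair_coloring_image:
  assumes "pair_coloring E' \<phi>" and sub: "(`) h ` E \<subseteq> E'" and inj: "inj_on h (\<Union>E)"
  shows "pair_coloring E (\<lambda>e. \<phi> (h ` e))"
proof -
  have col: "\<phi> (h ` e) \<inter> \<phi> (h ` f) = {}" if ef: "e \<in> E" "f \<in> E" "e \<noteq> f" "e \<inter> f \<noteq> {}" for e f
  proof -
    have "h ` e \<in> E'" "h ` f \<in> E'" using sub ef by blast+
    moreover have "h ` e \<noteq> h ` f"
      using inj_on_image_eq_iff[OF inj Union_upper Union_upper] ef by simp
    moreover have "h ` e \<inter> h ` f \<noteq> {}" using ef(4) by blast
    ultimately show ?thesis using assms(1) unfolding pair_coloring_def by simp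
  qed
  have range: "\<phi> (h ` e) \<subseteq> {1..6} \<and> card (\<phi> (h ` e)) = 2" if "e \<in> E" for e
  proof -
    have "h ` e \<in> E'" using sub that by blast
    then show ?thesis using assms(1) unfolding pair_coloring_def by simp
  qed
  show ?thesis
    unfolding pair_coloring_def using range col by simp
qed

section \<open>Compactness\<close>

text \<open>The functions from \<open>I\<close> to the finite discrete space \<open>L\<close> form a
  compact space, and each single constraint cuts out a closed set. Solvability on finite sets is the
  finite intersection property of these closed sets.\<close>

lemma binary_constraints_compactness:
  fixes I :: "'i set" and L :: "'l set" and R :: "'i \<Rightarrow> 'i \<Rightarrow> 'l \<Rightarrow> 'l \<Rightarrow> bool"
  assumes L: "finite L"
    and fin: "\<And>T. finite T \<Longrightarrow> T \<subseteq> I \<Longrightarrow> \<exists>\<phi>. \<phi> ` T \<subseteq> L \<and> (\<forall>i\<in>T. \<forall>j\<in>T. R i j (\<phi> i) (\<phi> j))"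
  shows "\<exists>\<phi>. \<phi> ` I \<subseteq> L \<and> (\<forall>i\<in>I. \<forall>j\<in>I. R i j (\<phi> i) (\<phi> j))"
proof -
  let ?X = "product_topology (\<lambda>_. discrete_topology L) I"
  define C where "C = (\<lambda>(i, j). {\<phi> \<in> topspace ?X. R i j (\<phi> i) (\<phi> j)})"
  have comp: "compact_space ?X"
    using L by (simp add: compact_space_product_topology compact_space_discrete_topology)
  have closed: "closedin ?X (C (i, j))" if ij: "i \<in> I" "j \<in> I" for i j
  proof -
    have pre: "closedin ?X {\<phi> \<in> topspace ?X. \<phi> k \<in> {a}}" if "k \<in> I" "a \<in> L" for k a
      by (rule closedin_continuous_map_preimage[OF continuous_map_product_projection])
        (use that in auto)
    \<comment> \<open>A constraint sees two coordinates with finitely many values, so it is a finite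
      union of closed cylinders, one for each allowed pair \<open>(a, b)\<close>.\<close>
    have "C (i, j) = (\<Union>(a, b)\<in>{(a, b)\<in>L \<times> L. R i j a b}.
        {\<phi> \<in> topspace ?X. \<phi> i \<in> {a}} \<inter> {\<phi> \<in> topspace ?X. \<phi> j \<in> {b}})"
      using ij by (auto simp: C_def)
    also have "closedin ?X \<dots>"
    proof (rule closedin_Union)
      show "finite ((\<lambda>(a, b). {\<phi> \<in> topspace ?X. \<phi> i \<in> {a}} \<inter> {\<phi> \<in> topspace ?X. \<phi> j \<in> {b}}) `
          {(a, b)\<in>L \<times> L. R i j a b})"
        using L by (intro finite_imageI finite_subset[OF _ finite_cartesian_product[OF L L]]) auto
    qed (use pre ij in \<open>auto intro!: closedin_Int simp del: topspace_product_topology\<close>)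
    finally show ?thesis .
  qed
  have "topspace ?X \<inter> \<Inter>(C ` (I \<times> I)) \<noteq> {}"
  proof -
    \<comment> \<open>The whole space is added to the family so that a common point lies in it even
      when \<open>I\<close> is empty and there are no constraints.\<close>
    have "\<Inter>\<F> \<noteq> {}" if F: "finite \<F>" "\<F> \<subseteq> insert (topspace ?X) (C ` (I \<times> I))" for \<F>
    proof -
      have "finite (\<F> - {topspace ?X})" "\<F> - {topspace ?X} \<subseteq> C ` (I \<times> I)" using F by auto
      then obtain S where S: "S \<subseteq> I \<times> I" "finite S" "\<F> - {topspace ?X} = C ` S"
        by (meson finite_subset_image)
      let ?T = "fst ` S \<union> snd ` S"
      have T: "finite ?T" "?T \<subseteq> I" using S by auto
      obtain \<phi> where \<phi>: "\<phi> ` ?T \<subseteq> L" "\<forall>i\<in>?T. \<forall>j\<in>?T. R i j (\<phi> i) (\<phi> j)"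
        using fin[OF T] by (elim exE conjE) (rule that)
      \<comment> \<open>Coordinates outside \<open>?T\<close> are filled with an arbitrary
        \<open>a \<in> L\<close>. An empty \<open>L\<close> forces \<open>I\<close> to be empty, by
        the hypothesis on one-element sets.\<close>
      obtain \<psi> where \<psi>: "\<psi> ` I \<subseteq> L" "\<forall>i\<in>?T. \<psi> i = \<phi> i"
      proof (cases "L = {}")
        case True
        have "i \<notin> I" for i
        proof
          assume "i \<in> I"
          then have "\<exists>\<phi>. \<phi> ` {i} \<subseteq> L" using fin[of "{i}"] by blast
          with True show False by simp
        qed
        then show ?thesis using that[of \<phi>] T(2) by blast
      next
        case False
        then obtain a where "a \<in> L" by blast
        then show ?thesis using that[of "\<lambda>i. if i \<in> ?T then \<phi> i else a"] \<phi>(1) by auto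
      qed
      \<comment> \<open>Points of the product space are extensional functions, hence the restriction
        to \<open>I\<close>.\<close>
      let ?\<psi> = "restrict \<psi> I"
      have top: "?\<psi> \<in> topspace ?X" using \<psi>(1) by auto
      have C: "?\<psi> \<in> C (i, j)" if "(i, j) \<in> S" for i j
      proof -
        have ij: "i \<in> ?T" "j \<in> ?T" using that by force+
        then have "R i j (\<phi> i) (\<phi> j)" using \<phi>(2) by blast
        moreover have "i \<in> I" "j \<in> I" using ij T(2) by blast+
        then have "?\<psi> i = \<phi> i" "?\<psi> j = \<phi> j" using \<psi>(2) ij by simp_all
        ultimately show ?thesis using top by (simp add: C_def del: topspace_product_topology)
      qed
      have "?\<psi> \<in> \<Inter>\<F>"
      proof
        fix A assume "A \<in> \<F>"
        then have "A = topspace ?X \<or> A \<in> C ` S" using S(3) by blast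
        then show "?\<psi> \<in> A"
        proof
          assume "A \<in> C ` S"
          then obtain i j where "(i, j) \<in> S" "A = C (i, j)" by fast
          then show ?thesis using C by simp
        next
          assume "A = topspace ?X"
          with top show ?thesis by (simp only:)
        qed
      qed
      then show ?thesis by blast
    qed
    moreover have "closedin ?X A" if A: "A \<in> insert (topspace ?X) (C ` (I \<times> I))" for A
    proof (cases "A = topspace ?X")
      case False
      then obtain i j where "i \<in> I" "j \<in> I" "A = C (i, j)" using A by fast
      then show ?thesis using closed by simp
    qed (simp only: closedin_topspace)
    ultimately have "\<Inter>(insert (topspace ?X) (C ` (I \<times> I))) \<noteq> {}"
      using comp unfolding compact_space_fip by meson
    then show ?thesis by (simp only: Inter_insert not_False_eq_True)
  qed
  then obtain \<phi> where \<phi>: "\<phi> \<in> topspace ?X" "\<And>i j. i \<in> I \<Longrightarrow> j \<in> I \<Longrightarrow> \<phi> \<in> C (i, j)" by blast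
  have "\<phi> ` I \<subseteq> L" using \<phi>(1) by auto
  moreover have "\<forall>i\<in>I. \<forall>j\<in>I. R i j (\<phi> i) (\<phi> j)" using \<phi>(2) by (auto simp: C_def)
  ultimately show ?thesis by blast
qed

lemma pair_coloring_compactness:
  assumes "\<And>T. finite T \<Longrightarrow> T \<subseteq> E \<Longrightarrow> \<exists>\<phi>. pair_coloring T \<phi>"
  shows "\<exists>\<phi>. pair_coloring E \<phi>"
proof -
  let ?L = "{A. A \<subseteq> {1..6::nat} \<and> card A = 2}"
  let ?R = "\<lambda>e f A B. e \<noteq> f \<and> e \<inter> f \<noteq> {} \<longrightarrow> A \<inter> B = {}"
  have eq: "pair_coloring T \<phi> \<longleftrightarrow> \<phi> ` T \<subseteq> ?L \<and> (\<forall>e\<in>T. \<forall>f\<in>T. ?R e f (\<phi> e) (\<phi> f))" for T \<phi>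
    unfolding pair_coloring_def image_subset_iff mem_Collect_eq ..
  have "finite ?L" by (rule finite_subset[of _ "Pow {1..6}"]) auto
  then show ?thesis
    unfolding eq by (rule binary_constraints_compactness) (rule assms[unfolded eq])
qed

section \<open>Injective images and copies of graphs\<close>

lemma simple_graph_Union: "simple_graph V E \<Longrightarrow> \<Union>E \<subseteq> V"
  by (auto simp: simple_graph_def)

lemma simple_graph_Un:
  "simple_graph V E \<Longrightarrow> simple_graph V F \<Longrightarrow> simple_graph V (E \<union> F)"
  unfolding simple_graph_def by (simp only: ball_Un simp_thms)

lemma simple_graph_image:
  assumes "simple_graph V E" and "inj_on h V"
  shows "simple_graph (h ` V) ((`) h ` E)"
  unfolding simple_graph_def
proof
  fix e' assume "e' \<in> (`) h ` E"
  then obtain e where "e \<in> E" "e' = h ` e" by blast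
  moreover obtain u v where uv: "u \<in> V" "v \<in> V" "u \<noteq> v" "e = {u, v}"
    using assms(1) \<open>e \<in> E\<close> by (rule simple_graph_edgeE)
  ultimately have "e' = {h u, h v}" by simp
  moreover have "h u \<noteq> h v" using inj_on_eq_iff[OF assms(2)] uv by simp
  ultimately show "\<exists>u\<in>h ` V. \<exists>v\<in>h ` V. u \<noteq> v \<and> e' = {u, v}"
    using uv(1,2) by (intro bexI[where x = "h u", OF bexI[where x = "h v"]] conjI imageI)
qed

lemma inj_on_image_edges:
  assumes "simple_graph V E" and "inj_on h V"
  shows "inj_on ((`) h) E"
  using assms inj_on_image_Pow[of h V] simple_graph_Union[of V E]
  by (auto intro: inj_on_subset)

lemma cubic_image:
  assumes G: "simple_graph V E" and "cubic V E" and inj: "inj_on h V"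
  shows "cubic (h ` V) ((`) h ` E)"
  unfolding cubic_def
proof
  fix x assume "x \<in> h ` V"
  then obtain v where v: "v \<in> V" "x = h v" by blast
  have mem: "h v \<in> h ` e \<longleftrightarrow> v \<in> e" if "e \<in> E" for e
    by (rule inj_on_image_mem_iff[OF inj v(1)]) (use simple_graph_Union[OF G] that in blast)
  have "{e \<in> (`) h ` E. x \<in> e} = (`) h ` {e \<in> E. x \<in> h ` e}" by blast
  also have "\<dots> = (`) h ` {e \<in> E. v \<in> e}" using mem v(2) by (simp cong: conj_cong)
  also have "card \<dots> = card {e \<in> E. v \<in> e}"
    by (rule card_image, rule inj_on_subset[OF inj_on_image_edges[OF G inj]]) blast
  also have "\<dots> = 3" using assms(2) v(1) by (simp add: cubic_def)
  finally show "card {e \<in> (`) h ` E. x \<in> e} = 3" .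
qed

text \<open>The auxiliary graphs live on product types, while the assumed statement speaks about one
  fixed vertex type. The graph is moved there by \<open>h\<close>, and the colouring found there is
  pulled back.\<close>

lemma pair_coloring_from_image:
  assumes "simple_graph V E" "cubic V E" "bridge_free E" "inj_on h V"
    and six: "simple_graph (h ` V) ((`) h ` E) \<Longrightarrow> cubic (h ` V) ((`) h ` E) \<Longrightarrow>
      bridgeless (h ` V) ((`) h ` E) \<Longrightarrow> six_matchings_double_cover (h ` V) ((`) h ` E)"
  shows "\<exists>\<phi>. pair_coloring E \<phi>"
proof -
  note G' = simple_graph_image[OF assms(1,4)] and cub' = cubic_image[OF assms(1,2,4)]
  have inj: "inj_on h (\<Union>E)"
    using assms(4) simple_graph_Union[OF assms(1)] by (rule inj_on_subset)
  have "bridgeless (h ` V) ((`) h ` E)"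
    using bridgeless_iff_bridge_free[OF G'] bridge_free_image[OF assms(3) inj] by blast
  then obtain \<phi> where "pair_coloring ((`) h ` E) \<phi>"
    using six[OF G' cub'] six_matchings_iff_pair_coloring[OF G' cub'] by blast
  then have "pair_coloring E (\<lambda>e. \<phi> (h ` e))" using order.refl inj by (rule pair_coloring_image)
  then show ?thesis by (rule exI[where P = "pair_coloring E"])
qed

text \<open>The index type determines the number of copies: \<open>bool\<close> gives the two copies
  in \<open>double\<close>, and \<open>nat\<close> the infinitely many in
  \<open>infinite_imp_finite\<close>.\<close>

definition copies :: "'a set set \<Rightarrow> ('i \<times> 'a) set set" where
  "copies E = (\<Union>i. (`) (Pair i) ` E)"

lemma simple_graph_copies:
  "simple_graph V E \<Longrightarrow> simple_graph (UNIV \<times> V) (copies E)"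
  unfolding simple_graph_def
proof
  fix e' :: "('b \<times> 'a) set"
  assume G: "\<forall>e\<in>E. \<exists>u\<in>V. \<exists>v\<in>V. u \<noteq> v \<and> e = {u, v}" and "e' \<in> copies E"
  then obtain i e where "e \<in> E" "e' = Pair i ` e" unfolding copies_def by blast
  then obtain u v where "u \<in> V" "v \<in> V" "u \<noteq> v" "e' = {(i, u), (i, v)}" using G by auto
  then show "\<exists>x\<in>UNIV \<times> V. \<exists>y\<in>UNIV \<times> V. x \<noteq> y \<and> e' = {x, y}"
    by (metis Pair_inject SigmaI UNIV_I)
qed

lemma edges_at_copies:
  "{e \<in> copies E. (i, v) \<in> e} = (`) (Pair i) ` {e \<in> E. v \<in> e}"
  by (auto simp: copies_def)

lemma card_image_Pair: "card ((`) (Pair i) ` S) = card S"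
  by (intro card_image inj_onI) (auto simp: inj_image_eq_iff inj_on_def)

lemma cubic_copies: "cubic V E \<Longrightarrow> cubic (UNIV \<times> V) (copies E)"
  by (auto simp: cubic_def edges_at_copies card_image_Pair)

lemma bridge_free_copies: "bridge_free E \<Longrightarrow> bridge_free (copies E)"
  unfolding copies_def
  by (rule bridge_free_Union) (auto intro!: bridge_free_image inj_onI)

section \<open>Completing a finite subgraph to a cubic graph\<close>

text \<open>The added edges are the rungs of a ladder between the two copies. They change the
  Boolean, whereas edges of \<open>copies F\<close> keep it, so no rung coincides with an edge of a
  copy.\<close>

definition double :: "'a set set \<Rightarrow> (bool \<times> 'a) set set" where
  "double F = copies F \<union> {{(False, v), (True, v)} |v. v \<in> \<Union>F \<and> card {e \<in> F. v \<in> e} = 2}"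

context
  fixes V :: "'a set" and E F :: "'a set set"
  assumes G: "simple_graph V E" and cub: "cubic V E" and bf: "bridge_free E"
    and FE: "F \<subseteq> E" and bfF: "bridge_free F"
begin

lemma simple_F: "simple_graph (\<Union>F) F"
  unfolding simple_graph_def
proof
  fix e assume e: "e \<in> F"
  then have "e \<in> E" using FE by blast
  with G obtain u v where uv: "u \<noteq> v" "e = {u, v}" by (rule simple_graph_edgeE)
  then have "u \<in> \<Union>F" "v \<in> \<Union>F" using e by blast+
  with uv show "\<exists>u\<in>\<Union>F. \<exists>v\<in>\<Union>F. u \<noteq> v \<and> e = {u, v}"
    by (intro bexI[where x = u, OF bexI[where x = v]] conjI)
qed

lemma card_edges_at:
  assumes "v \<in> V"
  shows "card {e \<in> E. v \<in> e} = 3" and "finite {e \<in> E. v \<in> e}"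
proof -
  show "card {e \<in> E. v \<in> e} = 3" using cub assms by (simp add: cubic_def)
  then show "finite {e \<in> E. v \<in> e}" by (simp add: card_ge_0_finite)
qed

text \<open>A single edge of \<open>F\<close> at \<open>v\<close> would be a bridge of
  \<open>F\<close>: its detour has to leave \<open>v\<close> along a second edge. The upper bound
  comes from \<open>E\<close>.\<close>

lemma degree_F:
  assumes "v \<in> \<Union>F"
  shows "card {e \<in> F. v \<in> e} = 2 \<or> card {e \<in> F. v \<in> e} = 3"
proof -
  have vV: "v \<in> V" using assms FE simple_graph_Union[OF G] by blast
  have sub: "{e \<in> F. v \<in> e} \<subseteq> {e \<in> E. v \<in> e}" using FE by blast
  then have le: "card {e \<in> F. v \<in> e} \<le> 3" and fin: "finite {e \<in> F. v \<in> e}"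
    using card_edges_at[OF vV] by (metis card_mono, metis finite_subset)
  obtain e where e: "e \<in> F" "v \<in> e" using assms by blast
  then obtain u where u: "u \<noteq> v" "e = {v, u}" using simple_graph_edge_at[OF simple_F] by blast
  then have "(v, u) \<in> (adj (F - {e}))\<^sup>*" using bfF e(1) unfolding bridge_free_def by blast
  then obtain w where "(v, w) \<in> adj (F - {e})" using u(1) by (cases rule: converse_rtranclE) auto
  then have "{e, {v, w}} \<subseteq> {e \<in> F. v \<in> e}" "e \<noteq> {v, w}" using e by auto
  then have "2 \<le> card {e \<in> F. v \<in> e}" using card_mono[OF fin, of "{e, {v, w}}"] by simp
  with le show ?thesis by linarith
qed

lemma edges_at_saturated:
  assumes "v \<in> \<Union>F" "card {e \<in> F. v \<in> e} = 3" "e \<in> E" "v \<in> e"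
  shows "e \<in> F"
proof -
  have vV: "v \<in> V" using assms(1) FE simple_graph_Union[OF G] by blast
  have "{e \<in> F. v \<in> e} = {e \<in> E. v \<in> e}"
    by (rule card_subset_eq) (use card_edges_at[OF vV] assms(2) FE in auto)
  then show ?thesis using assms(3,4) by blast
qed

text \<open>Otherwise every other vertex in the component of \<open>v\<close> in \<open>F\<close>
  has degree 3 in \<open>F\<close>, so all its edges of \<open>E\<close> belong to \<open>F\<close>.
  The detour around the third edge \<open>f\<close> at \<open>v\<close> then cannot leave
  \<open>F\<close>, and it ends at a vertex whose edges, including \<open>f\<close>, all lie in
  \<open>F\<close>.\<close>

lemma ex_other_degree_two:
  assumes v: "v \<in> \<Union>F" "card {e \<in> F. v \<in> e} = 2"
  shows "\<exists>w. w \<noteq> v \<and> w \<in> \<Union>F \<and> card {e \<in> F. w \<in> e} = 2 \<and> (v, w) \<in> (adj F)\<^sup>*"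
proof (rule ccontr)
  assume no: "\<not> ?thesis"
  have vV: "v \<in> V" using v(1) FE simple_graph_Union[OF G] by blast
  obtain f where f: "f \<in> E" "v \<in> f" "f \<notin> F"
  proof (rule ccontr)
    assume "\<not> thesis"
    then have "\<And>f. f \<in> E \<Longrightarrow> v \<in> f \<Longrightarrow> f \<in> F" using that by metis
    then have "{e \<in> E. v \<in> e} = {e \<in> F. v \<in> e}" using FE by blast
    then show False using card_edges_at(1)[OF vV] v(2) by simp
  qed
  obtain w where w: "w \<noteq> v" "f = {v, w}" using simple_graph_edge_at[OF G f(1,2)] by blast
  have third: "{e \<in> E. v \<in> e} = insert f {e \<in> F. v \<in> e}"
  proof (rule card_subset_eq[symmetric])
    have "finite {e \<in> F. v \<in> e}" using v(2) by (simp add: card_ge_0_finite)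
    then show "card (insert f {e \<in> F. v \<in> e}) = card {e \<in> E. v \<in> e}"
      using card_edges_at(1)[OF vV] v(2) f by simp
  qed (use card_edges_at[OF vV] FE f in auto)
  have sat: "e \<in> F" if "x \<noteq> v" "x \<in> \<Union>F" "(v, x) \<in> (adj F)\<^sup>*" "e \<in> E" "x \<in> e" for x e
    using no that degree_F[of x] edges_at_saturated[of x e] by metis
  have "(v, w) \<in> (adj (E - {f}))\<^sup>*" using bf f(1) w unfolding bridge_free_def by blast
  \<comment> \<open>The detour stays in the component of \<open>v\<close>: at \<open>v\<close>
    itself the only edges other than \<open>f\<close> are those of \<open>F\<close>, and elsewhere
    \<open>sat\<close> applies.\<close>
  then have "w \<in> \<Union>F \<and> (v, w) \<in> (adj F)\<^sup>*"
  proof (induction rule: rtrancl_induct)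
    case (step y z)
    have "{y, z} \<in> F"
    proof (cases "y = v")
      case True
      then have "{y, z} \<in> {e \<in> E. v \<in> e}" "{y, z} \<noteq> f" using step.hyps(2) by simp_all
      then show ?thesis unfolding third by blast
    next
      case False
      show ?thesis by (rule sat[OF False]) (use step in simp_all)
    qed
    then have "z \<in> \<Union>F" "(y, z) \<in> adj F" by (blast, simp)
    then show ?case using step.IH by (meson rtrancl_into_rtrancl)
  qed (use v in simp)
  then have "f \<in> F" by (intro sat[OF w(1)]) (use w(2) f(1) in simp_all)
  with f(3) show False by blast
qed

lemma simple_graph_double: "simple_graph (UNIV \<times> \<Union>F) (double F)"
proof -
  have "simple_graph (UNIV \<times> \<Union>F) (copies F)" using simple_F by (rule simple_graph_copies)
  moreover have "simple_graph (UNIV \<times> \<Union>F)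
      {{(False, v), (True, v)} |v. v \<in> \<Union>F \<and> card {e \<in> F. v \<in> e} = 2}"
    unfolding simple_graph_def
  proof
    fix e assume "e \<in> {{(False, v), (True, v)} |v. v \<in> \<Union>F \<and> card {e \<in> F. v \<in> e} = 2}"
    then obtain v where "v \<in> \<Union>F" "e = {(False, v), (True, v)}" by blast
    then show "\<exists>x\<in>UNIV \<times> \<Union>F. \<exists>y\<in>UNIV \<times> \<Union>F. x \<noteq> y \<and> e = {x, y}"
      by (metis Pair_inject SigmaI UNIV_I)
  qed
  ultimately show ?thesis unfolding double_def by (rule simple_graph_Un)
qed

lemma rung_notin_copies: "{(False, v), (True, v)} \<notin> copies F"
  by (auto simp: copies_def)

lemma cubic_double: "cubic (UNIV \<times> \<Union>F) (double F)"
  unfolding cubic_def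
proof
  fix x :: "bool \<times> 'a" assume "x \<in> UNIV \<times> \<Union>F"
  then obtain i v where x: "x = (i, v)" "v \<in> \<Union>F" by auto
  let ?S = "{e \<in> copies F. x \<in> e}" and ?r = "{(False, v), (True, v)}"
  have S: "card ?S = card {e \<in> F. v \<in> e}"
    unfolding x(1) edges_at_copies by (rule card_image_Pair)
  show "card {e \<in> double F. x \<in> e} = 3"
  proof (cases "card {e \<in> F. v \<in> e} = 2")
    case True
    then have "{e \<in> double F. x \<in> e} = insert ?r ?S"
      using x by (cases i) (auto simp: double_def)
    moreover have "finite ?S" using S True by (simp add: card_ge_0_finite)
    moreover have "?r \<notin> ?S" using rung_notin_copies by blast
    ultimately show ?thesis using S True by simp
  next
    case False
    then have "{e \<in> double F. x \<in> e} = ?S" using x(1) by (auto simp: double_def)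
    then show ?thesis using S False degree_F[OF x(2)] by simp
  qed
qed

text \<open>An edge of a copy has a detour inside \<open>copies F\<close>. The detour around the
  rung at \<open>v\<close> goes to another vertex \<open>w\<close> of degree 2 in one copy, crosses
  the rung at \<open>w\<close>, and returns in the other copy.\<close>

lemma bridge_free_double: "bridge_free (double F)"
  unfolding bridge_free_def
proof (intro allI impI)
  fix x y :: "bool \<times> 'a" assume xy: "{x, y} \<in> double F"
  have sub: "copies F \<subseteq> double F" by (auto simp: double_def)
  show "(x, y) \<in> (adj (double F - {{x, y}}))\<^sup>*"
  proof (cases "{x, y} \<in> copies F")
    case True
    then have "(x, y) \<in> (adj (copies F - {{x, y}}))\<^sup>*"
      using bridge_free_copies[OF bfF] unfolding bridge_free_def by blast
    then show ?thesis by (rule rtrancl_adj_mono) (use sub in blast)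
  next
    case False
    then obtain v where v: "{x, y} = {(False, v), (True, v)}" "v \<in> \<Union>F" "card {e \<in> F. v \<in> e} = 2"
      using xy unfolding double_def by blast
    obtain w where w: "w \<noteq> v" "w \<in> \<Union>F" "card {e \<in> F. w \<in> e} = 2" "(v, w) \<in> (adj F)\<^sup>*"
      using ex_other_degree_two[OF v(2,3)] by blast
    let ?A = "double F - {{x, y}}"
    have copy: "((i, v), (i, w)) \<in> (adj ?A)\<^sup>*" for i
    proof (rule rtrancl_adj_mono)
      show "((i, v), (i, w)) \<in> (adj ((`) (Pair i) ` F))\<^sup>*" using w(4) by (rule rtrancl_adj_image)
      show "(`) (Pair i) ` F \<subseteq> ?A" using sub False unfolding copies_def by blast
    qed
    have "{(False, w), (True, w)} \<noteq> {(False, v), (True, v)}" using w(1) by (auto simp: doubleton_eq_iff)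
    then have "((False, w), (True, w)) \<in> adj ?A" using w(2,3) v(1) by (auto simp: double_def)
    then have "((False, v), (True, v)) \<in> (adj ?A)\<^sup>*"
      using copy[of False] rtrancl_adj_sym[OF copy[of True]]
      by (meson rtrancl_into_rtrancl rtrancl_trans)
    moreover have "x = (False, v) \<and> y = (True, v) \<or> x = (True, v) \<and> y = (False, v)"
      using v(1) by (auto simp: doubleton_eq_iff)
    ultimately show ?thesis using rtrancl_adj_sym by metis
  qed
qed

end

section \<open>Equivalence of the finite and the infinite statement\<close>

lemma finite_imp_infinite:
  fixes V :: "'b set"
  assumes inf: "infinite (UNIV :: 'a set)"
    and all: "\<And>(V :: 'a set) E. simple_graph V E \<Longrightarrow> finite V \<Longrightarrow> cubic V E \<Longrightarrow> bridgeless V E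
            \<Longrightarrow> six_matchings_double_cover V E"
    and G: "simple_graph V E" "cubic V E" "bridgeless V E"
  shows "six_matchings_double_cover V E"
proof -
  have bf: "bridge_free E" using G bridgeless_iff_bridge_free by blast
  have "\<exists>\<phi>. pair_coloring T \<phi>" if "finite T" "T \<subseteq> E" for T
  proof -
    obtain F where F: "finite F" "T \<subseteq> F" "F \<subseteq> E" "bridge_free F"
      using bridge_free_finite_superset[OF G(1) bf \<open>finite T\<close> \<open>T \<subseteq> E\<close>] by blast
    note H = simple_graph_double[OF G(1,2) bf F(3,4)] cubic_double[OF G(1,2) bf F(3,4)]
      bridge_free_double[OF G(1,2) bf F(3,4)]
    have "finite e" if "e \<in> F" for e using that F(3) G(1) unfolding simple_graph_def by fastforce
    then have fin: "finite ((UNIV :: bool set) \<times> \<Union>F)" using F(1) by auto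
    \<comment> \<open>An infinite type contains finite sets of every size, so the finite doubled
      graph fits into \<open>'a\<close>.\<close>
    obtain h :: "bool \<times> 'b \<Rightarrow> 'a" where h: "inj_on h (UNIV \<times> \<Union>F)"
    proof -
      obtain B :: "'a set" where "finite B" "card B = card ((UNIV :: bool set) \<times> \<Union>F)"
        using infinite_arbitrarily_large[OF inf] by blast
      then show ?thesis using that fin finite_same_card_bij[OF fin] by (metis bij_betw_imp_inj_on)
    qed
    have "\<exists>\<phi>. pair_coloring (double F) \<phi>"
      by (rule pair_coloring_from_image[OF H h], rule all) (use fin in auto)
    then obtain \<phi> where \<phi>: "pair_coloring (double F) \<phi>" by blast
    have "(`) (Pair False) ` T \<subseteq> double F" using F(2) unfolding double_def copies_def by blast
    then show ?thesis using pair_coloring_image[OF \<phi>] by (blast intro: inj_onI)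
  qed
  then have "\<exists>\<phi>. pair_coloring E \<phi>" by (rule pair_coloring_compactness)
  then show ?thesis using six_matchings_iff_pair_coloring[OF G(1,2)] by blast
qed

lemma infinite_imp_finite:
  fixes V :: "'a set"
  assumes inf: "infinite (UNIV :: 'b set)"
    and all: "\<And>(V :: 'b set) E. simple_graph V E \<Longrightarrow> infinite V \<Longrightarrow> cubic V E \<Longrightarrow> bridgeless V E
            \<Longrightarrow> six_matchings_double_cover V E"
    and G: "simple_graph V E" "cubic V E" "bridgeless V E" and fin: "finite V"
  shows "six_matchings_double_cover V E"
proof (cases "V = {}")
  \<comment> \<open>Copies of the empty graph are empty, so this case cannot be reduced to an
    infinite graph and is settled directly.\<close>
  case True
  then have "E = {}" using G(1) by (auto simp: simple_graph_def)
  then have "pair_coloring E (\<lambda>_. {})" by (simp add: pair_coloring_def)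
  then show ?thesis using six_matchings_iff_pair_coloring[OF G(1,2)] by blast
next
  case False
  let ?W = "(UNIV :: nat set) \<times> V"
  have bf: "bridge_free E" using G bridgeless_iff_bridge_free by blast
  have H: "simple_graph ?W (copies E)" "cubic ?W (copies E)"
    "bridge_free (copies E :: (nat \<times> 'a) set set)"
    by (intro simple_graph_copies cubic_copies bridge_free_copies G bf)+
  have infW: "infinite ?W" using False by (simp add: finite_cartesian_product_iff)
  \<comment> \<open>The type \<open>'b\<close> may be no more than countable, so the embedding
    passes through the natural numbers.\<close>
  have "countable ?W" using fin by (simp add: countable_finite)
  then have "inj_on (to_nat_on ?W) ?W" by (rule inj_on_to_nat_on)
  moreover obtain g :: "nat \<Rightarrow> 'b" where "inj g" using infinite_countable_subset[OF inf] by blast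
  ultimately have h: "inj_on (g \<circ> to_nat_on ?W) ?W" by (meson comp_inj_on inj_on_subset subset_UNIV)
  have "\<exists>\<phi>. pair_coloring (copies E :: (nat \<times> 'a) set set) \<phi>"
    by (rule pair_coloring_from_image[OF H h], rule all)
      (use infW finite_imageD[OF _ h] in auto)
  then obtain \<phi> where \<phi>: "pair_coloring (copies E :: (nat \<times> 'a) set set) \<phi>" by blast
  have "(`) (Pair 0) ` E \<subseteq> (copies E :: (nat \<times> 'a) set set)" by (auto simp: copies_def)
  then have "pair_coloring E (\<lambda>e. \<phi> (Pair 0 ` e))"
    by (rule pair_coloring_image[OF \<phi>]) (auto intro: inj_onI)
  then show ?thesis using six_matchings_iff_pair_coloring[OF G(1,2)] by blast
qed

text \<open>The two vertex types are independent of each other. An infinite \<open>'a\<close> has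
  room for an isomorphic copy of every finite graph, and an infinite \<open>'b\<close> for one of
  every countable graph; the two directions rely on this.\<close>

theorem theorem3p2:
  assumes "infinite (UNIV :: 'a set)" and "infinite (UNIV :: 'b set)"
  shows "(\<forall>(V :: 'a set) E. simple_graph V E \<and> finite V \<and> cubic V E \<and> bridgeless V E
            \<longrightarrow> six_matchings_double_cover V E) \<longleftrightarrow>
         (\<forall>(V :: 'b set) E. simple_graph V E \<and> infinite V \<and> cubic V E \<and> bridgeless V E
            \<longrightarrow> six_matchings_double_cover V E)"
  using finite_imp_infinite[OF assms(1)] infinite_imp_finite[OF assms(2)] by blast

end
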